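(* Let $\lambda$ be an infinite cardinal. If $X \in \Gamma(\lambda) \cap \Delta(\lambda)$, then $\lambda \in dd(X)$, i.e. there is a dense subspace $D$ of $X$ with $d(D) = \lambda$.
   Context: Compact spaces are assumed Hausdorff. For a topological space $X$, $d(X)$ denotes its density (the least cardinality of a dense subset) and $w(X)$ its weight (the least cardinality of a base). The double density spectrum of $X$ is $dd(X) = \{d(D) : D \text{ is a dense subspace of } X\}$. A $G_\lambda$-set is an intersection of at most $\lambda$ many open sets. For an infinite cardinal $\lambda$: - $\Gamma(\lambda)$ is the class of all spaces in which every closed $G_\lambda$-set (as a subspace) has density $\le \lambda$. - $\Delta(\lambda)$ is the class of all compact spaces $X$ of weight $\ge \lambda$ in which there is a dense subset $S$ such that (i) $w(\overline{T}) < \lambda$ for every $T \subset S$ with $|T| < \lambda$, and (ii) whenever $f : X \to Y$ is a continuous surjection onto a Hausdorff space $Y$ with $w(Y) = \lambda$, then $|f[S]| = \lambda$. *)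

theory Defs
  imports "HOL-Analysis.Analysis"
begin

unbundle cardinal_syntax
no_notation elt_set_eq (infix \<open>=o\<close> 50)  (* ambiguous with equality of cardinals *)

text \<open>
  Cardinals are represented as in the cardinal library of Main: a cardinal is a cardinal order,
  compared with other cardinals, possibly over other types, by \<open>\<le>o\<close>, \<open><o\<close> and \<open>=o\<close>.
\<close>

definition least_card :: "'a set set \<Rightarrow> 'a rel" where
  "least_card \<A> = |SOME A. A \<in> \<A> \<and> (\<forall>B\<in>\<A>. |A| \<le>o |B| )|"

lemma least_card_attained:
  assumes "\<A> \<noteq> {}"
  obtains A where "A \<in> \<A>" "least_card \<A> = |A|"
proof -
  have "\<exists>r \<in> card_of ` \<A>. \<forall>r' \<in> card_of ` \<A>. r \<le>o r'"
    by (rule exists_minim_Card_order) (use assms in \<open>auto simp: card_of_Card_order\<close>)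
  then have "\<exists>A. A \<in> \<A> \<and> (\<forall>B\<in>\<A>. |A| \<le>o |B| )" by auto
  from someI_ex[OF this] show ?thesis
    using that unfolding least_card_def by blast
qed

lemma least_card_le:
  assumes "B \<in> \<A>"
  shows "least_card \<A> \<le>o |B|"
proof -
  have "\<exists>r \<in> card_of ` \<A>. \<forall>r' \<in> card_of ` \<A>. r \<le>o r'"
    by (rule exists_minim_Card_order) (use assms in \<open>auto simp: card_of_Card_order\<close>)
  then have "\<exists>A. A \<in> \<A> \<and> (\<forall>B\<in>\<A>. |A| \<le>o |B| )" by auto
  from someI_ex[OF this] show ?thesis
    using assms unfolding least_card_def by blast
qed

definition dense_in :: "'a topology \<Rightarrow> 'a set \<Rightarrow> bool" where
  "dense_in X D \<longleftrightarrow> D \<subseteq> topspace X \<and> X closure_of D = topspace X"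

definition base_of :: "'a topology \<Rightarrow> 'a set set \<Rightarrow> bool" where
  "base_of X \<B> \<longleftrightarrow> (\<forall>V\<in>\<B>. openin X V) \<and>
     (\<forall>U x. openin X U \<and> x \<in> U \<longrightarrow> (\<exists>V\<in>\<B>. x \<in> V \<and> V \<subseteq> U))"

definition density :: "'a topology \<Rightarrow> 'a rel" where
  "density X = least_card {D. dense_in X D}"

definition weight :: "'a topology \<Rightarrow> 'a set rel" where
  "weight X = least_card {\<B>. base_of X \<B>}"

definition dd :: "'a topology \<Rightarrow> 'a rel set" where
  "dd X = {density (subtopology X D) | D. dense_in X D}"

definition G_set :: "'k rel \<Rightarrow> 'a topology \<Rightarrow> 'a set \<Rightarrow> bool" where
  "G_set \<mu> X A \<longleftrightarrow>
     (\<exists>\<U>. |\<U>| \<le>o \<mu> \<and> (\<forall>U\<in>\<U>. openin X U) \<and> A = topspace X \<inter> \<Inter>\<U>)"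

definition Gamma_spaces :: "'k rel \<Rightarrow> 'a topology set" where
  "Gamma_spaces \<mu> = {X. \<forall>A. closedin X A \<and> G_set \<mu> X A \<longrightarrow> density (subtopology X A) \<le>o \<mu>}"

text \<open>
  In \<open>Delta_spaces\<close> the target spaces \<open>Y\<close> are taken with points in the type of the points of \<open>X\<close>. This is
  no restriction, as a surjective image of \<open>X\<close> has at most as many points as \<open>X\<close>; see
  \<open>Delta_any_target\<close> below.
\<close>

definition Delta_spaces :: "'k rel \<Rightarrow> 'a topology set" where
  "Delta_spaces \<mu> = {X. compact_space X \<and> Hausdorff_space X \<and> \<mu> \<le>o weight X \<and>
     (\<exists>S. dense_in X S \<and>
        (\<forall>T. T \<subseteq> S \<and> |T| <o \<mu> \<longrightarrow> weight (subtopology X (X closure_of T)) <o \<mu>) \<and>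
        (\<forall>(Y :: 'a topology) f.
           Hausdorff_space Y \<and> weight Y =o \<mu> \<and>
           continuous_map X Y f \<and> f ` topspace X = topspace Y \<longrightarrow> |f ` S| =o \<mu>))}"

lemma base_of_openin: "base_of X {U. openin X U}"
  unfolding base_of_def by auto

lemma weight_le_homeomorphic:
  assumes "homeomorphic_maps X Y g h"
  shows "weight Y \<le>o weight X"
proof -
  obtain \<B> where B: "base_of X \<B>" "weight X = |\<B>|"
    unfolding weight_def using least_card_attained[of "{\<B>. base_of X \<B>}"] base_of_openin[of X]
    by (metis empty_iff mem_Collect_eq)
  have hm: "homeomorphic_map X Y g" "homeomorphic_map Y X h"
    using assms homeomorphic_maps_map by blast+
  have gh: "g (h y) = y" if "y \<in> topspace Y" for y
    using assms that by (auto simp: homeomorphic_maps_def)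
  have "base_of Y ((`) g ` \<B>)"
    unfolding base_of_def
  proof (intro conjI ballI allI impI)
    fix V assume "V \<in> (`) g ` \<B>"
    then show "openin Y V"
      using B(1) homeomorphic_map_openness_eq[OF hm(1)] unfolding base_of_def by auto
  next
    fix U y assume U: "openin Y U \<and> y \<in> U"
    then have "openin X (h ` U)"
      using hm(2) by (meson homeomorphic_map_openness_eq)
    then obtain V where V: "V \<in> \<B>" "h y \<in> V" "V \<subseteq> h ` U"
      using B(1) U unfolding base_of_def by (meson imageI)
    have "U \<subseteq> topspace Y" using U openin_subset by blast
    then have "g ` V \<subseteq> U" "y \<in> g ` V"
      using V U gh by (force, metis image_eqI subsetD)
    then show "\<exists>W\<in>(`) g ` \<B>. y \<in> W \<and> W \<subseteq> U" using V(1) by blast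
  qed
  then have "weight Y \<le>o |(`) g ` \<B>|"
    unfolding weight_def by (intro least_card_le) simp
  also have "|(`) g ` \<B>| \<le>o weight X"
    unfolding B(2) by (rule card_of_image)
  finally show ?thesis .
qed

lemma Delta_any_target:
  fixes X :: "'a topology" and \<mu> :: "'k rel"
  assumes S: "S \<subseteq> topspace X"
    and targets: "\<And>(Y :: 'a topology) f. \<lbrakk>Hausdorff_space Y; weight Y =o \<mu>;
        continuous_map X Y f; f ` topspace X = topspace Y\<rbrakk> \<Longrightarrow> |f ` S| =o \<mu>"
    and Y: "Hausdorff_space (Y :: 'b topology)" "weight Y =o \<mu>"
    and f: "continuous_map X Y f" "f ` topspace X = topspace Y"
  shows "|f ` S| =o \<mu>"
proof -
  define s where "s = inv_into (topspace X) f"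
  have fs: "f (s y) = y" if "y \<in> topspace Y" for y
    using that f(2) by (simp add: s_def f_inv_into_f)
  have inj: "inj_on s (topspace Y)"
    using fs by (metis inj_onI)
  define Z where "Z = pullback_topology (s ` topspace Y) f Y"
  have topZ: "topspace Z = s ` topspace Y"
    using fs by (auto simp: Z_def topspace_pullback_topology)
  have fZ: "continuous_map Z Y f"
    unfolding Z_def using continuous_map_pullback[OF continuous_map_id[of Y], of "s ` topspace Y" f] by simp
  have sZ: "continuous_map Y Z s"
    unfolding Z_def
  proof (rule continuous_map_pullback')
    show "continuous_map Y Y (f \<circ> s)"
      by (rule continuous_map_eq[OF continuous_map_id]) (simp add: fs)
    show "topspace Y \<subseteq> s -` (s ` topspace Y)" by auto
  qed
  have hom: "homeomorphic_maps Y Z s f"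
    using fZ sZ fs by (auto simp: homeomorphic_maps_def topZ)
  then have hom': "homeomorphic_maps Z Y f s"
    using homeomorphic_maps_sym by blast
  have "weight Z =o weight Y"
    using weight_le_homeomorphic[OF hom] weight_le_homeomorphic[OF hom'] ordIso_iff_ordLeq by blast
  then have wZ: "weight Z =o \<mu>" using Y(2) ordIso_transitive by blast
  have HZ: "Hausdorff_space Z"
    using Y(1) hom homeomorphic_Hausdorff_space homeomorphic_space_def by blast
  have "|(s \<circ> f) ` S| =o \<mu>"
  proof (rule targets[OF HZ wZ])
    show "continuous_map X Z (s \<circ> f)" using f(1) sZ continuous_map_compose by blast
    show "(s \<circ> f) ` topspace X = topspace Z" using f(2) topZ by (metis image_comp)
  qed
  moreover have "inj_on s (f ` S)"
    by (rule inj_on_subset[OF inj]) (use S f(2) in blast)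
  then have "bij_betw s (f ` S) ((s \<circ> f) ` S)"
    by (simp add: bij_betw_def image_comp)
  then have "|f ` S| =o |(s \<circ> f) ` S|"
    by (rule card_of_ordIsoI)
  ultimately show ?thesis
    by (blast intro: ordIso_transitive)
qed

end

theory Submission
  imports Defs
begin

text \<open>
  The heart of the matter is a continuous image \<open>Y\<close> of \<open>X\<close>, under a map \<open>e\<close> say, which is
  Hausdorff and has weight exactly \<open>\<mu>\<close>. Let \<open>S\<close> be the dense set that witnesses membership in
  \<^const>\<open>Delta_spaces\<close>. Then \<open>e[S]\<close> has cardinality \<open>\<mu>\<close>. As \<open>w(Y) = \<mu>\<close>, every fibre of \<open>e\<close> is a
  closed \<open>G\<^sub>\<mu>\<close>-set and so has a dense subset of size at most \<open>\<mu>\<close>. Let \<open>D\<close> be the union of such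
  subsets over the fibres of the points of \<open>e[S]\<close>. The closure of \<open>D\<close> contains \<open>S\<close>, so \<open>D\<close> is dense,
  and \<open>|D| \<le> \<mu>\<close>. Conversely let \<open>E\<close> be dense in \<open>D\<close> with \<open>|E| < \<mu>\<close>. Since \<open>e[E]\<close> lies in \<open>e[S]\<close>,
  some \<open>T \<subseteq> S\<close> with \<open>|T| < \<mu>\<close> has \<open>e[T] = e[E]\<close>, and the compact set \<open>e[cl T]\<close> contains the
  dense set \<open>e[E]\<close>, so \<open>cl T\<close> maps onto \<open>Y\<close>. But \<open>cl T\<close> has weight less than \<open>\<mu>\<close>, and no space of such a
  weight can be mapped continuously onto \<open>Y\<close>, by the argument that bounds the weight of \<open>Y\<close> from below.

  The image \<open>Y\<close> is obtained by evaluating at most \<open>\<mu>\<close> real functions on \<open>X\<close> simultaneously, which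
  bounds its weight from above (\<open>weight_eval_image_le\<close>). For the lower bound, well-order all continuous
  real functions on \<open>X\<close> and keep those that are not determined by their predecessors, i.e. that separate
  two points on which all smaller functions agree. The functions kept still separate points, since the
  least function to separate two given points is kept; hence for uncountable \<open>\<mu>\<close> there are at least
  \<open>\<mu>\<close> of them (\<open>weight_le_separating\<close>). Pick \<open>\<mu>\<close> of these. A base with at most \<open>\<nu>\<close>
  members, where \<open>\<nu> < \<mu>\<close> is infinite, would provide, for any set \<open>J\<close> of the chosen functions, a
  subset \<open>G\<close> of size at most \<open>\<nu>\<close> that separates the same points (\<open>resolved_by_few\<close>). If \<open>J\<close> has more than \<open>\<nu>\<close> members,
  each with at most \<open>\<nu>\<close> predecessors, then some member of \<open>J\<close> lies above all of \<open>G\<close> and yet is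
  determined by \<open>G\<close>, which is impossible (\<open>unresolvable_independent\<close>). For countable \<open>\<mu>\<close> it suffices to
  separate the points of a countably infinite set.

  Both lower bounds on weights, that of \<open>Y\<close> and that of \<open>cl T\<close>, rest on the same property of the
  family of functions, which is therefore stated for arbitrary families of sets in place of bases
  (\<open>resolves\<close>).
\<close>

section \<open>Cardinal arithmetic\<close>

lemma countable_ordLeq_Cinfinite:
  assumes "countable A" "Cinfinite r"
  shows "|A| \<le>o r"
proof -
  obtain g :: "'a \<Rightarrow> nat" where "inj_on g A"
    using assms(1) by (auto simp: countable_def)
  then have "|A| \<le>o |UNIV :: nat set|"
    using card_of_ordLeq[of A "UNIV :: nat set"] by blast
  also have "|UNIV :: nat set| \<le>o r"
    using assms(2) ordIso_ordLeq_trans[OF card_of_nat natLeq_ordLeq_cinfinite] by blast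
  finally show ?thesis .
qed

lemma card_of_Times_bound:
  assumes "|A| \<le>o r" "|B| \<le>o r" "Cinfinite r"
  shows "|A \<times> B| \<le>o r"
  using assms card_of_Times_ordLeq_infinite_Field unfolding cinfinite_def by blast

lemma not_ordLeq_imp_ordLess:
  assumes "\<not> r \<le>o s" "Card_order r" "Card_order s"
  shows "s <o r"
  using assms(1) not_ordLeq_iff_ordLess[of s r]
    card_order_on_well_order_on[OF assms(2)] card_order_on_well_order_on[OF assms(3)] by simp

lemma Cinfinite_Plus_nat: "Cinfinite |A <+> (UNIV :: nat set)|"
proof
  show "cinfinite |A <+> (UNIV :: nat set)|"
    by (simp add: cinfinite_def Field_card_of)
qed (rule card_of_Card_order)

lemma card_of_Fpow_bound:
  assumes A: "|A| \<le>o r" and r: "Cinfinite r"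
  shows "|Fpow A| \<le>o r"
proof -
  define L where "L n = {P. P \<subseteq> A \<and> finite P \<and> card P = n}" for n
  have "|L n| \<le>o r" for n
  proof (induction n)
    case 0
    have "L 0 \<subseteq> {{}}" by (auto simp: L_def)
    then have "countable (L 0)" by (rule countable_subset) simp
    then show ?case using r by (rule countable_ordLeq_Cinfinite)
  next
    case (Suc n)
    have "L (Suc n) \<subseteq> (\<lambda>(a, P). insert a P) ` (A \<times> L n)"
    proof
      fix P assume P: "P \<in> L (Suc n)"
      then obtain a where a: "a \<in> P" by (force simp: L_def)
      have "P - {a} \<in> L n" using P a by (auto simp: L_def)
      moreover have "P = insert a (P - {a})" "a \<in> A" using P a by (auto simp: L_def)
      ultimately show "P \<in> (\<lambda>(a, P). insert a P) ` (A \<times> L n)"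
        by (intro image_eqI[of _ _ "(a, P - {a})"]) auto
    qed
    then have "|L (Suc n)| \<le>o |A \<times> L n|"
      using card_of_mono1 card_of_image ordLeq_transitive by blast
    then show ?case
      using card_of_Times_bound[OF A Suc.IH r] ordLeq_transitive by blast
  qed
  then have "|\<Union>n\<in>UNIV. L n| \<le>o r"
    using r by (intro UNION_Cinfinite_bound countable_ordLeq_Cinfinite) auto
  moreover have "Fpow A = (\<Union>n\<in>UNIV. L n)"
    by (auto simp: Fpow_def L_def)
  ultimately show ?thesis by simp
qed

section \<open>Density and weight\<close>

lemma weight_attained:
  obtains \<B> where "base_of X \<B>" "weight X = |\<B>|"
  using least_card_attained[of "{\<B>. base_of X \<B>}"] base_of_openin[of X]
  unfolding weight_def by blast

lemma weight_le: "base_of X \<B> \<Longrightarrow> weight X \<le>o |\<B>|"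
  unfolding weight_def by (simp add: least_card_le)

lemma dense_in_topspace: "dense_in X (topspace X)"
  by (simp add: dense_in_def)

lemma density_attained:
  obtains D where "dense_in X D" "density X = |D|"
  using least_card_attained[of "{D. dense_in X D}"] dense_in_topspace[of X]
  unfolding density_def by blast

lemma density_le: "dense_in X D \<Longrightarrow> density X \<le>o |D|"
  unfolding density_def by (simp add: least_card_le)

text \<open>
  Density inside a subspace is expressed by closures in the whole space, where all density arguments
  below take place.
\<close>

lemma dense_in_subtopology:
  assumes "A \<subseteq> topspace X"
  shows "dense_in (subtopology X A) E \<longleftrightarrow> E \<subseteq> A \<and> A \<subseteq> X closure_of E"
  using assms by (auto simp: dense_in_def closure_of_subtopology Int_absorb1)

lemma infinite_weight_imp_infinite_topspace:
  assumes "Cinfinite \<mu>" "\<mu> \<le>o weight X"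
  shows "infinite (topspace X)"
proof
  assume "finite (topspace X)"
  moreover have "{U. openin X U} \<subseteq> Pow (topspace X)" by (auto dest: openin_subset)
  ultimately have "finite {U. openin X U}" by (meson finite_Pow_iff finite_subset)
  moreover have "\<mu> \<le>o |{U. openin X U}|"
    using assms(2) weight_le[OF base_of_openin] ordLeq_transitive by blast
  ultimately show False
    using assms(1) by (metis Field_card_of cinfinite_def cinfinite_mono)
qed

section \<open>Evaluation in products of lines\<close>

definition evaluation :: "('a \<Rightarrow> real) set \<Rightarrow> 'a \<Rightarrow> ('a \<Rightarrow> real) \<Rightarrow> real" where
  "evaluation F x = (\<lambda>f\<in>F. f x)"

definition eval_image :: "'a topology \<Rightarrow> ('a \<Rightarrow> real) set \<Rightarrow> (('a \<Rightarrow> real) \<Rightarrow> real) topology" where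
  "eval_image X F = subtopology (product_topology (\<lambda>_. euclideanreal) F) (evaluation F ` topspace X)"

lemma evaluation_eq_iff: "evaluation F x = evaluation F y \<longleftrightarrow> (\<forall>f\<in>F. f x = f y)"
  by (auto simp: evaluation_def fun_eq_iff)

lemma topspace_eval_image: "topspace (eval_image X F) = evaluation F ` topspace X"
  by (auto simp: eval_image_def evaluation_def)

lemma Hausdorff_eval_image: "Hausdorff_space (eval_image X F)"
  unfolding eval_image_def by (simp add: Hausdorff_space_subtopology Hausdorff_space_product_topology)

lemma continuous_map_evaluation:
  assumes "\<forall>f\<in>F. continuous_map X euclideanreal f"
  shows "continuous_map X (eval_image X F) (evaluation F)"
proof -
  have "continuous_map X (product_topology (\<lambda>_. euclideanreal) F) (evaluation F)"
    unfolding continuous_map_componentwise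
  proof (intro conjI ballI)
    show "evaluation F ` topspace X \<subseteq> extensional F"
      by (auto simp: evaluation_def)
    fix f assume f: "f \<in> F"
    have "(\<lambda>x. evaluation F x f) = f" using f by (auto simp: evaluation_def)
    then show "continuous_map X euclideanreal (\<lambda>x. evaluation F x f)"
      using assms f by simp
  qed
  then show ?thesis
    unfolding eval_image_def by (simp add: continuous_map_in_subtopology)
qed

lemma continuous_map_coordinate:
  assumes "f \<in> F"
  shows "continuous_map (eval_image X F) euclideanreal (\<lambda>y. y f)"
  unfolding eval_image_def
  by (rule continuous_map_from_subtopology)
     (use assms continuous_map_product_coordinates[of f F "\<lambda>_. euclideanreal"] in simp)

text \<open>
  Boxes with rational sides that constrain finitely many coordinates form a base, and there are at
  most \<open>max(|F|, \<omega>)\<close> constraints on single coordinates.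
\<close>

lemma weight_eval_image_le:
  assumes F: "|F| \<le>o r" and r: "Cinfinite r"
  shows "weight (eval_image X F) \<le>o r"
proof -
  define Y where "Y = eval_image X F"
  define box where
    "box P = {y \<in> topspace Y. \<forall>(f, a, b)\<in>P. of_rat a < y f \<and> y f < of_rat b}"
    for P :: "(('a \<Rightarrow> real) \<times> rat \<times> rat) set"
  define I where "I = F \<times> (UNIV :: (rat \<times> rat) set)"
  have "base_of Y (box ` Fpow I)"
    unfolding base_of_def
  proof (intro conjI ballI allI impI)
    fix V assume "V \<in> box ` Fpow I"
    then obtain P where P: "finite P" "P \<subseteq> I" "V = box P" by (auto simp: Fpow_def)
    have op: "openin Y {y \<in> topspace Y. y f \<in> {of_rat a<..<of_rat b}}" if "(f, a, b) \<in> P" for f a b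
      using that P(2) continuous_map_coordinate[of f F X] unfolding Y_def I_def
      by (intro openin_continuous_map_preimage[of _ euclideanreal]) auto
    have "openin Y (topspace Y \<inter>
        (\<Inter>(f, a, b)\<in>P. {y \<in> topspace Y. y f \<in> {of_rat a<..<of_rat b}}))"
    proof (cases "P = {}")
      case False
      then show ?thesis using P(1) op by (intro openin_Int openin_INT) auto
    qed simp
    also have "topspace Y \<inter>
        (\<Inter>(f, a, b)\<in>P. {y \<in> topspace Y. y f \<in> {of_rat a<..<of_rat b}}) = V"
      unfolding P(3) box_def by auto
    finally show "openin Y V" .
  next
    fix U y assume Uy: "openin Y U \<and> y \<in> U"
    then obtain W where W: "openin (product_topology (\<lambda>_. euclideanreal) F) W"
        "U = W \<inter> evaluation F ` topspace X"
      by (auto simp: Y_def eval_image_def openin_subtopology)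
    then obtain W' where W': "finite {f \<in> F. W' f \<noteq> UNIV}" "\<forall>f\<in>F. open (W' f)"
        "y \<in> Pi\<^sub>E F W'" "Pi\<^sub>E F W' \<subseteq> W"
      using Uy by (auto simp: openin_product_topology_alt)
    have "\<exists>p. y f \<in> {of_rat (fst p)<..<of_rat (snd p)} \<and> {of_rat (fst p)<..<of_rat (snd p)} \<subseteq> W' f"
      if f: "f \<in> F" for f
    proof -
      have "open (W' f)" "y f \<in> W' f" using W' f by (auto simp: PiE_iff)
      then obtain e where e: "e > 0" "ball (y f) e \<subseteq> W' f"
        using openE by blast
      obtain a b where ab: "y f - e < of_rat a" "of_rat a < y f" "y f < of_rat b" "of_rat b < y f + e"
        using of_rat_dense[of "y f - e" "y f"] of_rat_dense[of "y f" "y f + e"] e(1) by auto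
      have "{of_rat a<..<of_rat b} \<subseteq> ball (y f) e"
        using ab by (auto simp: dist_real_def)
      then show ?thesis using ab e(2) by (intro exI[of _ "(a, b)"]) auto
    qed
    then obtain p where p: "\<And>f. f \<in> F \<Longrightarrow> y f \<in> {of_rat (fst (p f))<..<of_rat (snd (p f))}"
        "\<And>f. f \<in> F \<Longrightarrow> {of_rat (fst (p f))<..<of_rat (snd (p f))} \<subseteq> W' f"
      by metis
    define P where "P = (\<lambda>f. (f, p f)) ` {f \<in> F. W' f \<noteq> UNIV}"
    have "P \<in> Fpow I" using W'(1) by (auto simp: P_def I_def Fpow_def)
    moreover have "y \<in> box P"
      using Uy p(1) openin_subset[of Y U] by (fastforce simp: P_def box_def split: prod.splits)
    moreover have "box P \<subseteq> U"
    proof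
      fix z assume z: "z \<in> box P"
      then have zX: "z \<in> evaluation F ` topspace X"
        by (simp add: box_def Y_def topspace_eval_image)
      have "z f \<in> W' f" if f: "f \<in> F" for f
      proof (cases "W' f = UNIV")
        case False
        then have "(f, fst (p f), snd (p f)) \<in> P" using f by (simp add: P_def)
        moreover have "\<forall>(f, a, b)\<in>P. of_rat a < z f \<and> z f < of_rat b"
          using z by (simp add: box_def)
        ultimately have "z f \<in> {of_rat (fst (p f))<..<of_rat (snd (p f))}"
          by (auto dest: bspec)
        then show ?thesis using p(2)[OF f] by blast
      qed simp
      moreover have "z \<in> extensional F" using zX by (auto simp: evaluation_def)
      ultimately have "z \<in> Pi\<^sub>E F W'" by (simp add: PiE_iff)
      then show "z \<in> U" using W'(4) W(2) zX by blast
    qed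
    ultimately show "\<exists>V\<in>box ` Fpow I. y \<in> V \<and> V \<subseteq> U" by blast
  qed
  then have "weight Y \<le>o |box ` Fpow I|" by (rule weight_le)
  also have "|box ` Fpow I| \<le>o |Fpow I|" by (rule card_of_image)
  also have "|Fpow I| \<le>o r"
    unfolding I_def
    by (intro card_of_Fpow_bound card_of_Times_bound F r countable_ordLeq_Cinfinite) auto
  finally show ?thesis unfolding Y_def .
qed

section \<open>Families of functions that no small family of sets resolves\<close>

text \<open>
  A base of a topology for which the members of \<open>F\<close> are continuous resolves \<open>F\<close>. The notion retains just
  enough of a base to bound its cardinality from below, and unlike a base it can be moved along maps
  that are not continuous.
\<close>

definition resolves :: "'a set \<Rightarrow> ('a \<Rightarrow> real) set \<Rightarrow> 'a set set \<Rightarrow> bool" where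
  "resolves M F \<B> \<longleftrightarrow> (\<forall>f\<in>F. \<forall>x\<in>M. \<forall>y\<in>M. f x \<noteq> f y \<longrightarrow>
     (\<exists>U\<in>\<B>. \<exists>V\<in>\<B>. x \<in> U \<and> y \<in> V \<and> f ` U \<inter> f ` V = {}))"

text \<open>
  Each member of the base is replaced by the set of all points of \<open>M\<close> at which \<open>F\<close> takes the values of
  one of its points, so that disjoint ranges of values stay disjoint. With \<open>h\<close> as a parameter
  this covers the section of an evaluation map as well as the inclusion of a subspace with the same
  tuples of values.
\<close>

lemma resolves_pullback:
  assumes \<B>: "base_of Z \<B>"
    and cont: "\<And>f. f \<in> F \<Longrightarrow> continuous_map Z euclideanreal (\<lambda>z. f (h z))"
    and onto: "\<And>x. x \<in> M \<Longrightarrow> \<exists>z\<in>topspace Z. \<forall>f\<in>F. f (h z) = f x"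
  shows "resolves M F ((\<lambda>U. {x \<in> M. \<exists>z\<in>U. \<forall>f\<in>F. f (h z) = f x}) ` \<B>)"
  unfolding resolves_def
proof (intro ballI impI)
  fix f x y assume f: "f \<in> F" and x: "x \<in> M" and y: "y \<in> M" and ne: "f x \<noteq> f y"
  obtain u where u: "u \<in> topspace Z" "\<forall>f\<in>F. f (h u) = f x" using onto[OF x] by blast
  obtain v where v: "v \<in> topspace Z" "\<forall>f\<in>F. f (h v) = f y" using onto[OF y] by blast
  obtain A B where AB: "open A" "open B" "f x \<in> A" "f y \<in> B" "A \<inter> B = {}"
    using hausdorff[OF ne] by blast
  have "openin Z {z \<in> topspace Z. f (h z) \<in> A}" "openin Z {z \<in> topspace Z. f (h z) \<in> B}"
    using openin_continuous_map_preimage[OF cont[OF f]] AB by auto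
  then obtain U V where UV: "U \<in> \<B>" "u \<in> U" "U \<subseteq> {z \<in> topspace Z. f (h z) \<in> A}"
      "V \<in> \<B>" "v \<in> V" "V \<subseteq> {z \<in> topspace Z. f (h z) \<in> B}"
    using \<B> u v f AB(3,4) unfolding base_of_def
    by (metis (mono_tags, lifting) mem_Collect_eq)
  let ?s = "\<lambda>U. {x \<in> M. \<exists>z\<in>U. \<forall>f\<in>F. f (h z) = f x}"
  have "f ` ?s U \<subseteq> A" "f ` ?s V \<subseteq> B" using UV f by fastforce+
  then have "f ` ?s U \<inter> f ` ?s V = {}" using AB(5) by blast
  moreover have "x \<in> ?s U" "y \<in> ?s V" using UV u v x y by auto
  ultimately show "\<exists>U\<in>?s ` \<B>. \<exists>V\<in>?s ` \<B>. x \<in> U \<and> y \<in> V \<and> f ` U \<inter> f ` V = {}"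
    using UV(1,4) by (intro bexI[of _ "?s U"] bexI[of _ "?s V"] conjI imageI)
qed

lemma weight_ge_if_unresolvable:
  assumes unres: "\<And>\<B>. resolves M F \<B> \<Longrightarrow> \<mu> \<le>o |\<B>|"
    and cont: "\<And>f. f \<in> F \<Longrightarrow> continuous_map Z euclideanreal (\<lambda>z. f (h z))"
    and onto: "\<And>x. x \<in> M \<Longrightarrow> \<exists>z\<in>topspace Z. \<forall>f\<in>F. f (h z) = f x"
  shows "\<mu> \<le>o weight Z"
proof -
  obtain \<B> where \<B>: "base_of Z \<B>" "weight Z = |\<B>|" by (rule weight_attained)
  show ?thesis
    using unres[OF resolves_pullback[OF \<B>(1) cont onto]] card_of_image[of _ \<B>]
    unfolding \<B>(2) by (meson ordLeq_transitive)
qed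

text \<open>
  One function from \<open>J\<close> is chosen for each pair of members of \<open>\<B>\<close> that some function in \<open>J\<close> keeps apart.
\<close>

lemma resolved_by_few:
  assumes "resolves M J \<B>"
  obtains G where "G \<subseteq> J" "|G| \<le>o |\<B> \<times> \<B>|"
    "\<And>x y f. \<lbrakk>x \<in> M; y \<in> M; \<forall>g\<in>G. g x = g y; f \<in> J\<rbrakk> \<Longrightarrow> f x = f y"
proof -
  define Q where "Q = (\<lambda>(U, V) f. f \<in> J \<and> f ` U \<inter> f ` V = {})"
  define P where "P = {p \<in> \<B> \<times> \<B>. \<exists>f. Q p f}"
  define c where "c p = (SOME f. Q p f)" for p
  have c: "Q p (c p)" if "p \<in> P" for p
    using that someI_ex[of "Q p"] unfolding c_def P_def by blast
  show ?thesis
  proof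
    show "c ` P \<subseteq> J" using c by (auto simp: Q_def)
    have "P \<subseteq> \<B> \<times> \<B>" by (auto simp: P_def)
    then show "|c ` P| \<le>o |\<B> \<times> \<B>|"
      using ordLeq_transitive[OF card_of_image card_of_mono1] by blast
    fix x y f assume *: "x \<in> M" "y \<in> M" "\<forall>g\<in>c ` P. g x = g y" "f \<in> J"
    show "f x = f y"
    proof (rule ccontr)
      assume "f x \<noteq> f y"
      then obtain U V where UV: "U \<in> \<B>" "V \<in> \<B>" "x \<in> U" "y \<in> V" "f ` U \<inter> f ` V = {}"
        using assms[unfolded resolves_def, rule_format, OF *(4,1,2)] by blast
      then have "(U, V) \<in> P" using *(4) by (auto simp: P_def Q_def)
      then have "c (U, V) ` U \<inter> c (U, V) ` V = {}" "c (U, V) x = c (U, V) y"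
        using c[of "(U, V)"] * by (auto simp: Q_def)
      then show False using UV by blast
    qed
  qed
qed

lemma separating_function:
  assumes "compact_space X" "Hausdorff_space X" "x \<in> topspace X" "y \<in> topspace X" "x \<noteq> y"
  obtains f where "continuous_map X euclideanreal f" "f x \<noteq> f y"
proof -
  have "completely_regular_space X"
    using assms by (simp add: compact_Hausdorff_or_regular_imp_normal_space
        normal_imp_completely_regular_space)
  moreover have "closedin X {y}"
    using assms by (simp add: closedin_Hausdorff_singleton)
  moreover have "x \<in> topspace X - {y}"
    using assms by blast
  ultimately obtain f where f: "continuous_map X (top_of_set {0..1::real}) f" "f x = 0" "f ` {y} \<subseteq> {1}"
    unfolding completely_regular_space_def by metis
  have "continuous_map X euclideanreal f"
    using f(1) continuous_map_into_fulltopology by blast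
  then show ?thesis
    using that[of f] f(2,3) by auto
qed

text \<open>
  Functions that separate the points of an infinite set \<open>N\<close> pairwise cannot be resolved by a finite
  family \<open>\<B>\<close>, since a point of \<open>N\<close> is then determined by the members of \<open>\<B>\<close> that contain it.
\<close>

lemma unresolvable_countable:
  assumes X: "compact_space X" "Hausdorff_space X" and inf: "infinite (topspace X)"
  obtains F where "\<forall>f\<in>F. continuous_map X euclideanreal f" "countable F"
    "\<And>\<B>. resolves (topspace X) F \<B> \<Longrightarrow> infinite \<B>"
proof -
  obtain N where N: "N \<subseteq> topspace X" "countable N" "infinite N"
    using infinite_countable_subset'[OF inf] by blast
  have "\<exists>f. continuous_map X euclideanreal f \<and> (fst p \<noteq> snd p \<longrightarrow> f (fst p) \<noteq> f (snd p))"
    if "p \<in> N \<times> N" for p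
  proof (cases "fst p = snd p")
    case True
    then show ?thesis by (intro exI[of _ "\<lambda>_. 0"]) auto
  next
    case False
    then show ?thesis
      using that N(1) separating_function[OF X, of "fst p" "snd p"] by (metis mem_Times_iff subsetD)
  qed
  then obtain s where "\<forall>p\<in>N \<times> N. continuous_map X euclideanreal (s p) \<and>
      (fst p \<noteq> snd p \<longrightarrow> s p (fst p) \<noteq> s p (snd p))"
    using bchoice[of "N \<times> N" "\<lambda>p f. continuous_map X euclideanreal f \<and>
      (fst p \<noteq> snd p \<longrightarrow> f (fst p) \<noteq> f (snd p))"] by blast
  then have s: "\<And>p. p \<in> N \<times> N \<Longrightarrow> continuous_map X euclideanreal (s p)"
      "\<And>x y. \<lbrakk>x \<in> N; y \<in> N; x \<noteq> y\<rbrakk> \<Longrightarrow> s (x, y) x \<noteq> s (x, y) y"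
    by force+
  show ?thesis
  proof
    show "\<forall>f\<in>s ` (N \<times> N). continuous_map X euclideanreal f" using s(1) by blast
    show "countable (s ` (N \<times> N))" using N(2) by blast
    fix \<B> assume res: "resolves (topspace X) (s ` (N \<times> N)) \<B>"
    show "infinite \<B>"
    proof
      assume "finite \<B>"
      have "inj_on (\<lambda>x. {U \<in> \<B>. x \<in> U}) N"
      proof (rule inj_onI, rule ccontr)
        fix x y assume *: "x \<in> N" "y \<in> N" "{U \<in> \<B>. x \<in> U} = {U \<in> \<B>. y \<in> U}" "x \<noteq> y"
        let ?f = "s (x, y)"
        have "?f \<in> s ` (N \<times> N)" "?f x \<noteq> ?f y" using * s(2) by auto
        then obtain U V where UV: "U \<in> \<B>" "V \<in> \<B>" "x \<in> U" "y \<in> V" "?f ` U \<inter> ?f ` V = {}"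
          using res[unfolded resolves_def, rule_format, of ?f x y] *(1,2) N(1) by blast
        then have "y \<in> U" using *(3) by blast
        then show False using UV by blast
      qed
      moreover have "(\<lambda>x. {U \<in> \<B>. x \<in> U}) ` N \<subseteq> Pow \<B>" by auto
      ultimately have "finite N"
        using \<open>finite \<B>\<close> by (meson finite_Pow_iff inj_on_finite)
      then show False using N(3) by blast
    qed
  qed
qed

text \<open>
  If some element of \<open>I\<close> has more than \<open>|A|\<close> predecessors, then a minimal such element has more than
  \<open>|A|\<close> predecessors with at most \<open>|A|\<close> predecessors each. This replaces an initial segment whose order
  type is the successor cardinal of \<open>|A|\<close>.
\<close>

lemma many_elements_with_few_predecessors:
  assumes R: "wf R" and I: "|A| <o |I|"
  obtains J where "J \<subseteq> I" "|A| <o |J|" "\<And>f. f \<in> J \<Longrightarrow> |{g \<in> I. (g, f) \<in> R}| \<le>o |A|"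
proof -
  define lo where "lo f = {g \<in> I. (g, f) \<in> R}" for f
  define J where "J = {f \<in> I. |lo f| \<le>o |A|}"
  have "|A| <o |J|"
  proof (cases "J = I")
    case False
    then obtain f0 where "f0 \<in> I - J" unfolding J_def by blast
    then obtain f where f: "f \<in> I - J" "\<And>g. (g, f) \<in> R \<Longrightarrow> g \<notin> I - J"
      using wfE_min[OF R] by metis
    then have "lo f \<subseteq> J" unfolding lo_def by blast
    then have "|lo f| \<le>o |J|" by (rule card_of_mono1)
    moreover have "|A| <o |lo f|"
    proof (rule not_ordLeq_imp_ordLess)
      show "\<not> |lo f| \<le>o |A|" using f(1) unfolding J_def by blast
    qed (rule card_of_Card_order)+
    ultimately show ?thesis using ordLess_ordLeq_trans by blast
  qed (use I in simp)
  then show ?thesis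
  proof (rule that[rotated])
    show "J \<subseteq> I" by (auto simp: J_def)
    show "|{g \<in> I. (g, f) \<in> R}| \<le>o |A|" if "f \<in> J" for f
      using that unfolding J_def lo_def by simp
  qed
qed

text \<open>
  If \<open>\<B>\<close> were smaller than \<open>I\<close>, a set \<open>J \<subseteq> I\<close> larger than \<open>\<B>\<close> whose members have only few
  predecessors would separate the same points as a set \<open>G \<subseteq> J\<close> that is no larger than \<open>\<B>\<close>. The members
  of \<open>G\<close> and their predecessors do not exhaust \<open>J\<close>, and any other member of \<open>J\<close> is above all of \<open>G\<close>,
  so by independence it separates points that \<open>G\<close> does not separate.
\<close>

lemma unresolvable_independent:
  fixes I :: "('a \<Rightarrow> real) set"
  assumes R: "wf R" "total_on I R"
    and indep: "\<And>f. f \<in> I \<Longrightarrow> \<exists>x\<in>M. \<exists>y\<in>M. (\<forall>g\<in>I. (g, f) \<in> R \<longrightarrow> g x = g y) \<and> f x \<noteq> f y"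
    and res: "resolves M I \<B>"
    and unc: "natLeq <o |I|"
  shows "|I| \<le>o |\<B>|"
proof (rule ccontr)
  assume "\<not> |I| \<le>o |\<B>|"
  then have less: "|\<B>| <o |I|"
    by (rule not_ordLeq_imp_ordLess) (rule card_of_Card_order)+
  have I: "infinite I" using unc ordLess_imp_ordLeq infinite_iff_natLeq_ordLeq by blast
  \<comment> \<open>The summand of natural numbers makes \<open>A\<close> infinite; it stays smaller than the uncountable \<open>I\<close>.\<close>
  define A where "A = \<B> <+> (UNIV :: nat set)"
  have "|UNIV :: nat set| <o |I|" using card_of_nat unc ordIso_ordLess_trans by blast
  then have A: "|A| <o |I|"
    unfolding A_def using less I by (intro card_of_Plus_ordLess_infinite)
  have cA: "Cinfinite |A|"
    unfolding A_def by (rule Cinfinite_Plus_nat)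
  obtain J where J: "J \<subseteq> I" "|A| <o |J|" "\<And>f. f \<in> J \<Longrightarrow> |{g \<in> I. (g, f) \<in> R}| \<le>o |A|"
    using many_elements_with_few_predecessors[OF R(1) A] by blast
  have "resolves M J \<B>" using res J(1) unfolding resolves_def by blast
  then obtain G where G: "G \<subseteq> J" "|G| \<le>o |\<B> \<times> \<B>|"
    "\<And>x y f. \<lbrakk>x \<in> M; y \<in> M; \<forall>g\<in>G. g x = g y; f \<in> J\<rbrakk> \<Longrightarrow> f x = f y"
    using resolved_by_few by blast
  have BA: "|\<B>| \<le>o |A|" unfolding A_def by (rule card_of_Plus1)
  have GA: "|G| \<le>o |A|"
    using G(2) card_of_Times_bound[OF BA BA cA] ordLeq_transitive by blast
  define L where "L g = insert g {h \<in> I. (h, g) \<in> R}" for g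
  have "|L g| \<le>o |A|" if "g \<in> G" for g
  proof -
    have "g \<in> J" using that G(1) by blast
    then have "|{g} \<union> {h \<in> I. (h, g) \<in> R}| \<le>o |A|"
      by (intro Un_Cinfinite_bound J(3) cA countable_ordLeq_Cinfinite[OF _ cA]) auto
    then show ?thesis by (simp add: L_def)
  qed
  then have "|\<Union>g\<in>G. L g| \<le>o |A|"
    using GA cA by (intro UNION_Cinfinite_bound) auto
  then have "\<not> J \<subseteq> (\<Union>g\<in>G. L g)"
    using J(2) card_of_mono1 ordLeq_transitive not_ordLess_ordLeq by blast
  then obtain f where f: "f \<in> J" "\<And>g. g \<in> G \<Longrightarrow> f \<notin> L g" by blast
  have above: "(g, f) \<in> R" if "g \<in> G" for g
    using that f G(1) J(1) R(2) unfolding L_def total_on_def by blast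
  obtain x y where xy: "x \<in> M" "y \<in> M" "\<forall>g\<in>I. (g, f) \<in> R \<longrightarrow> g x = g y" "f x \<noteq> f y"
    using indep f(1) J(1) by blast
  have "\<forall>g\<in>G. g x = g y" using xy(3) above G(1) J(1) by blast
  from G(3)[OF xy(1,2) this f(1)] xy(4) show False by contradiction
qed

text \<open>
  A compact space is homeomorphic to its image under a continuous injection into a Hausdorff space,
  here under the evaluation of a point-separating family.
\<close>

lemma weight_le_separating:
  assumes X: "compact_space X" "Hausdorff_space X"
    and F: "\<forall>f\<in>F. continuous_map X euclideanreal f"
    and sep: "\<And>x y. \<lbrakk>x \<in> topspace X; y \<in> topspace X; x \<noteq> y\<rbrakk> \<Longrightarrow> \<exists>f\<in>F. f x \<noteq> f y"
    and card: "|F| \<le>o r" "Cinfinite r"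
  shows "weight X \<le>o r"
proof -
  have "homeomorphic_map X (eval_image X F) (evaluation F)"
  proof (rule continuous_imp_homeomorphic_map)
    show "inj_on (evaluation F) (topspace X)"
      using sep by (auto simp: inj_on_def evaluation_eq_iff)
  qed (use X F in \<open>auto simp: continuous_map_evaluation Hausdorff_eval_image topspace_eval_image\<close>)
  then obtain g where "homeomorphic_maps X (eval_image X F) (evaluation F) g"
    using homeomorphic_map_maps by blast
  then have "weight X \<le>o weight (eval_image X F)"
    using weight_le_homeomorphic homeomorphic_maps_sym by blast
  then show ?thesis using weight_eval_image_le[OF card] ordLeq_transitive by blast
qed

text \<open>
  The functions of the family are taken from the set \<open>D\<close> of those that separate two points on which
  all smaller functions, in a well-order of all continuous functions, agree. Countable \<open>\<mu>\<close> needs a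
  different family, as \<open>D\<close> can then be finite: the identity alone separates the points of the unit
  interval.
\<close>

lemma exists_unresolvable:
  fixes X :: "'a topology" and \<mu> :: "'k rel"
  assumes X: "compact_space X" "Hausdorff_space X" and \<mu>: "Cinfinite \<mu>" "\<mu> \<le>o weight X"
  obtains F where "\<forall>f\<in>F. continuous_map X euclideanreal f" "|F| \<le>o \<mu>"
    "\<And>\<B>. resolves (topspace X) F \<B> \<Longrightarrow> \<mu> \<le>o |\<B>|"
proof (cases "\<mu> \<le>o natLeq")
  case True
  obtain F where F: "\<forall>f\<in>F. continuous_map X euclideanreal f" "countable F"
    "\<And>\<B>. resolves (topspace X) F \<B> \<Longrightarrow> infinite \<B>"
    using unresolvable_countable[OF X infinite_weight_imp_infinite_topspace[OF \<mu>]] by blast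
  have "\<mu> \<le>o |\<B>|" if "resolves (topspace X) F \<B>" for \<B>
    using F(3)[OF that] True infinite_iff_natLeq_ordLeq ordLeq_transitive by blast
  then show ?thesis
    using that F(1) countable_ordLeq_Cinfinite[OF F(2) \<mu>(1)] by blast
next
  case False
  then have unc: "natLeq <o \<mu>"
    using not_ordLeq_imp_ordLess[OF False _ natLeq_Card_order] \<mu>(1) by simp
  obtain r :: "('a \<Rightarrow> real) rel" where "well_order_on UNIV r"
    using well_order_on by blast
  moreover define R where "R = r - Id"
  ultimately have R: "wf R" "total_on M R" for M
    by (auto simp: well_order_on_def linear_order_on_def total_on_def)
  define C where "C = {f. continuous_map X euclideanreal f}"
  define D where "D = {f \<in> C. \<exists>x\<in>topspace X. \<exists>y\<in>topspace X.
      (\<forall>g\<in>C. (g, f) \<in> R \<longrightarrow> g x = g y) \<and> f x \<noteq> f y}"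
  \<comment> \<open>The least function that separates two points belongs to \<open>D\<close>.\<close>
  have sep: "\<exists>f\<in>D. f x \<noteq> f y" if xy: "x \<in> topspace X" "y \<in> topspace X" "x \<noteq> y" for x y
  proof -
    obtain f0 where f0: "f0 \<in> {f \<in> C. f x \<noteq> f y}"
      using separating_function[OF X xy] unfolding C_def by blast
    obtain f where "f \<in> {f \<in> C. f x \<noteq> f y}"
        "\<And>g. (g, f) \<in> R \<Longrightarrow> g \<notin> {f \<in> C. f x \<noteq> f y}"
      by (rule wfE_min[OF R(1) f0]) blast
    then show ?thesis using xy(1,2) unfolding D_def by blast
  qed
  have "\<mu> \<le>o |D|"
  proof (rule ccontr)
    assume "\<not> \<mu> \<le>o |D|"
    then have "|D| <o \<mu>"
      by (rule not_ordLeq_imp_ordLess) (rule conjunct2[OF \<mu>(1)] card_of_Card_order)+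
    moreover have "|UNIV :: nat set| <o \<mu>" using card_of_nat unc ordIso_ordLess_trans by blast
    ultimately have "|D <+> (UNIV :: nat set)| <o \<mu>"
      using \<mu>(1) card_of_Plus_ordLess_infinite_Field unfolding cinfinite_def by blast
    moreover have "weight X \<le>o |D <+> (UNIV :: nat set)|"
    proof (rule weight_le_separating[OF X _ sep])
      show "\<forall>f\<in>D. continuous_map X euclideanreal f" by (auto simp: D_def C_def)
    qed (assumption | rule card_of_Plus1 Cinfinite_Plus_nat)+
    ultimately show False
      using \<mu>(2) ordLeq_ordLess_trans not_ordLess_ordLeq by blast
  qed
  then obtain I where I: "I \<subseteq> D" "\<mu> =o |I|"
  proof -
    have "|Field \<mu>| \<le>o |D|"
      using \<mu>(1) \<open>\<mu> \<le>o |D|\<close> card_of_Field_ordIso ordIso_ordLeq_trans by blast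
    then obtain e where e: "inj_on e (Field \<mu>)" "e ` Field \<mu> \<subseteq> D"
      using card_of_ordLeq[of "Field \<mu>" D] by blast
    then have "|Field \<mu>| =o |e ` Field \<mu>|"
      by (intro card_of_ordIsoI[of e]) (simp add: bij_betw_def)
    then have "\<mu> =o |e ` Field \<mu>|"
      using \<mu>(1) card_of_Field_ordIso ordIso_symmetric ordIso_transitive by blast
    then show ?thesis using e(2) that by blast
  qed
  have "\<mu> \<le>o |\<B>|" if res: "resolves (topspace X) I \<B>" for \<B>
  proof -
    have "|I| \<le>o |\<B>|"
    proof (rule unresolvable_independent[OF R _ res])
      show "\<exists>x\<in>topspace X. \<exists>y\<in>topspace X. (\<forall>g\<in>I. (g, f) \<in> R \<longrightarrow> g x = g y) \<and> f x \<noteq> f y"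
        if "f \<in> I" for f
        using that I(1) unfolding D_def by blast
      show "natLeq <o |I|" using unc I(2) ordLess_ordIso_trans by blast
    qed
    then show ?thesis using I(2) ordIso_ordLeq_trans by blast
  qed
  moreover have "\<forall>f\<in>I. continuous_map X euclideanreal f" using I(1) by (auto simp: D_def C_def)
  moreover have "|I| \<le>o \<mu>" using I(2) ordIso_iff_ordLeq by blast
  ultimately show ?thesis using that by blast
qed

section \<open>The dense subspace\<close>

text \<open>
  A point of a Hausdorff space is the intersection of the basic open sets that contain it.
\<close>

lemma G_set_fibre:
  assumes Y: "Hausdorff_space Y" and f: "continuous_map X Y f" and y: "y \<in> topspace Y"
    and w: "weight Y \<le>o \<mu>"
  shows "closedin X {x \<in> topspace X. f x = y}" "G_set \<mu> X {x \<in> topspace X. f x = y}"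
proof -
  have cl: "closedin Y {y}" using Y y by (simp add: closedin_Hausdorff_singleton)
  show "closedin X {x \<in> topspace X. f x = y}"
    using closedin_continuous_map_preimage[OF f cl] by simp
  obtain \<B> where \<B>: "base_of Y \<B>" "weight Y = |\<B>|" by (rule weight_attained)
  define \<U> where "\<U> = (\<lambda>B. {x \<in> topspace X. f x \<in> B}) ` {B \<in> \<B>. y \<in> B}"
  have "|\<U>| \<le>o |{B \<in> \<B>. y \<in> B}|" unfolding \<U>_def by (rule card_of_image)
  also have "|{B \<in> \<B>. y \<in> B}| \<le>o |\<B>|" by (rule card_of_mono1) auto
  also have "|\<B>| \<le>o \<mu>" using w \<B>(2) by simp
  finally have "|\<U>| \<le>o \<mu>" .
  moreover have "\<forall>U\<in>\<U>. openin X U"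
    using \<B>(1) f unfolding \<U>_def base_of_def by (auto intro: openin_continuous_map_preimage)
  moreover have "{x \<in> topspace X. f x = y} = topspace X \<inter> \<Inter>\<U>"
  proof (intro equalityI subsetI)
    fix x assume x: "x \<in> topspace X \<inter> \<Inter>\<U>"
    have "f x = y"
    proof (rule ccontr)
      assume "f x \<noteq> y"
      moreover have "f x \<in> topspace Y" using x f by (auto simp: continuous_map_def)
      ultimately obtain W where "openin Y W" "y \<in> W" "f x \<notin> W"
        using Y y unfolding Hausdorff_space_def disjnt_def by (metis disjoint_iff)
      then obtain B where "B \<in> \<B>" "y \<in> B" "f x \<notin> B"
        using \<B>(1) unfolding base_of_def by blast
      then show False using x unfolding \<U>_def by blast
    qed
    then show "x \<in> {x \<in> topspace X. f x = y}" using x by blast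
  qed (auto simp: \<U>_def)
  ultimately show "G_set \<mu> X {x \<in> topspace X. f x = y}"
    unfolding G_set_def by blast
qed

theorem theorem3p2:
  fixes \<mu> :: "'k rel" and X :: "'a topology"
  assumes "Cinfinite \<mu>" and "X \<in> Gamma_spaces \<mu> \<inter> Delta_spaces \<mu>"
  shows "\<exists>\<kappa> \<in> dd X. \<kappa> =o \<mu>"
proof -
  have gam: "density (subtopology X A) \<le>o \<mu>" if "closedin X A" "G_set \<mu> X A" for A
    using assms(2) that unfolding Gamma_spaces_def by blast
  have X: "compact_space X" "Hausdorff_space X" "\<mu> \<le>o weight X"
    using assms(2) unfolding Delta_spaces_def by auto
  obtain S where S: "dense_in X S"
    and small: "\<And>T. \<lbrakk>T \<subseteq> S; |T| <o \<mu>\<rbrakk> \<Longrightarrow> weight (subtopology X (X closure_of T)) <o \<mu>"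
    and targets: "\<And>(Y :: 'a topology) f. \<lbrakk>Hausdorff_space Y; weight Y =o \<mu>;
           continuous_map X Y f; f ` topspace X = topspace Y\<rbrakk> \<Longrightarrow> |f ` S| =o \<mu>"
    using assms(2) unfolding Delta_spaces_def by auto
  have SX: "S \<subseteq> topspace X" "X closure_of S = topspace X"
    using S by (auto simp: dense_in_def)
  obtain F where F: "\<forall>f\<in>F. continuous_map X euclideanreal f" "|F| \<le>o \<mu>"
    and unres: "\<And>\<B>. resolves (topspace X) F \<B> \<Longrightarrow> \<mu> \<le>o |\<B>|"
    using exists_unresolvable[OF X(1,2) assms(1) X(3)] by blast
  define Y where "Y = eval_image X F"
  define e where "e = evaluation F"
  have eY: "continuous_map X Y e" "e ` topspace X = topspace Y" "Hausdorff_space Y"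
    using F(1) by (simp_all add: Y_def e_def continuous_map_evaluation topspace_eval_image
        Hausdorff_eval_image)
  have e_eq: "f x = f y" if "e x = e y" "f \<in> F" for x y f
    using that unfolding e_def evaluation_eq_iff by blast

  \<comment> \<open>A base of \<open>Y\<close> is carried back to \<open>X\<close> along a section of \<open>e\<close>, which need not be continuous.\<close>
  have "\<mu> \<le>o weight Y"
  proof (rule weight_ge_if_unresolvable[OF unres, where h = "inv_into (topspace X) e"])
    have inv: "f (inv_into (topspace X) e y) = y f" if "y \<in> topspace Y" "f \<in> F" for f y
    proof -
      have "e (inv_into (topspace X) e y) = y"
        using that(1) eY(2) by (simp add: f_inv_into_f)
      then have "e (inv_into (topspace X) e y) f = y f" by simp
      then show ?thesis using that(2) by (simp add: e_def evaluation_def)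
    qed
    show "continuous_map Y euclideanreal (\<lambda>y. f (inv_into (topspace X) e y))" if f: "f \<in> F" for f
      by (rule continuous_map_eq[OF continuous_map_coordinate[OF f, of X, folded Y_def]])
         (simp add: inv f)
    show "\<exists>y\<in>topspace Y. \<forall>f\<in>F. f (inv_into (topspace X) e y) = f x" if x: "x \<in> topspace X" for x
    proof (intro bexI ballI)
      show ex: "e x \<in> topspace Y" using x eY(2) by blast
      show "f (inv_into (topspace X) e (e x)) = f x" if "f \<in> F" for f
        using inv[OF ex that] that by (simp add: e_def evaluation_def)
    qed
  qed
  moreover have wY: "weight Y \<le>o \<mu>"
    unfolding Y_def by (rule weight_eval_image_le[OF F(2) assms(1)])
  ultimately have "weight Y =o \<mu>" using ordIso_iff_ordLeq by blast
  then have eS: "|e ` S| =o \<mu>"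
    by (intro Delta_any_target[OF SX(1) _ eY(3) _ eY(1,2)] targets)

  define fib where "fib y = {x \<in> topspace X. e x = y}" for y
  have "\<exists>D. D \<subseteq> fib y \<and> fib y \<subseteq> X closure_of D \<and> |D| \<le>o \<mu>" if y: "y \<in> e ` S" for y
  proof -
    have "y \<in> topspace Y" using y SX(1) eY(2) by blast
    then have "density (subtopology X (fib y)) \<le>o \<mu>"
      unfolding fib_def by (intro gam G_set_fibre[OF eY(3,1) _ wY])
    moreover obtain D where "dense_in (subtopology X (fib y)) D"
        "density (subtopology X (fib y)) = |D|"
      by (rule density_attained)
    moreover have "fib y \<subseteq> topspace X" by (auto simp: fib_def)
    ultimately show ?thesis using dense_in_subtopology by metis
  qed
  then obtain d where d: "\<And>y. y \<in> e ` S \<Longrightarrow> d y \<subseteq> fib y"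
      "\<And>y. y \<in> e ` S \<Longrightarrow> fib y \<subseteq> X closure_of d y" "\<And>y. y \<in> e ` S \<Longrightarrow> |d y| \<le>o \<mu>"
    by metis
  define D where "D = (\<Union>y\<in>e ` S. d y)"
  have DX: "D \<subseteq> topspace X" using d(1) by (auto simp: D_def fib_def)
  \<comment> \<open>The closure of \<open>D\<close> contains the whole fibre through each point of \<open>S\<close>.\<close>
  have "S \<subseteq> X closure_of D"
  proof
    fix x assume x: "x \<in> S"
    then have "x \<in> X closure_of d (e x)" using d(2)[of "e x"] SX(1) by (auto simp: fib_def)
    moreover have "d (e x) \<subseteq> D" using x by (auto simp: D_def)
    ultimately show "x \<in> X closure_of D" using closure_of_mono by blast
  qed
  then have "topspace X \<subseteq> X closure_of D"
    using SX(2) closure_of_minimal closedin_closure_of by metis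
  then have DD: "dense_in X D" "X closure_of D = topspace X"
    using DX closure_of_subset_topspace[of X D] by (auto simp: dense_in_def)
  have cardD: "|D| \<le>o \<mu>"
    unfolding D_def using d(3) eS assms(1) by (intro UNION_Cinfinite_bound ordIso_imp_ordLeq) auto
  have "dense_in (subtopology X D) D"
    using dense_in_subtopology[OF DX] closure_of_subset[OF DX] by simp
  then have "density (subtopology X D) \<le>o \<mu>"
    using density_le cardD ordLeq_transitive by blast
  moreover have "\<mu> \<le>o density (subtopology X D)"
  proof (rule ccontr)
    assume "\<not> \<mu> \<le>o density (subtopology X D)"
    moreover obtain E where E: "dense_in (subtopology X D) E" "density (subtopology X D) = |E|"
      by (rule density_attained)
    ultimately have "\<not> \<mu> \<le>o |E|" by simp
    then have smallE: "|E| <o \<mu>"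
      by (rule not_ordLeq_imp_ordLess) (rule conjunct2[OF assms(1)] card_of_Card_order)+
    have ED: "E \<subseteq> D" "D \<subseteq> X closure_of E" using E(1) dense_in_subtopology[OF DX] by auto
    then have Edense: "X closure_of E = topspace X"
      using DD(2) closure_of_minimal[OF ED(2) closedin_closure_of] closure_of_subset_topspace[of X E]
      by blast
    have "e ` E \<subseteq> e ` S"
      using ED(1) d(1) by (force simp: D_def fib_def)
    then obtain T where T: "T \<subseteq> S" "e ` T = e ` E" "inj_on e T"
      using subset_image_inj[of "e ` E" e S] by metis
    have "|T| =o |e ` E|"
      using T by (intro card_of_ordIsoI[of e]) (simp add: bij_betw_def)
    then have "|T| <o \<mu>"
      using card_of_image[of e E] smallE ordIso_ordLeq_trans ordLeq_ordLess_trans by blast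
    \<comment> \<open>\<open>K\<close> has small weight but, by compactness, the same image under \<open>e\<close> as the whole of \<open>X\<close>.\<close>
    define K where "K = X closure_of T"
    have TK: "T \<subseteq> K" "K \<subseteq> topspace X"
      using T(1) SX(1) closure_of_subset[of T X] closure_of_subset_topspace[of X T]
      unfolding K_def by auto
    have "weight (subtopology X K) <o \<mu>"
      unfolding K_def by (rule small[OF T(1) \<open>|T| <o \<mu>\<close>])
    moreover have "\<mu> \<le>o weight (subtopology X K)"
    proof (rule weight_ge_if_unresolvable[OF unres, where h = id])
      show "continuous_map (subtopology X K) euclideanreal (\<lambda>z. f (id z))" if "f \<in> F" for f
        using F(1) that by (simp add: continuous_map_from_subtopology)
      fix x assume x: "x \<in> topspace X"
      have "compactin X K"
        unfolding K_def using X(1) by (simp add: closedin_compact_space)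
      then have "closedin Y (e ` K)"
        using image_compactin[OF _ eY(1)] compactin_imp_closedin[OF eY(3)] by blast
      moreover have "e ` E \<subseteq> e ` K" using T(2) TK(1) by blast
      ultimately have "Y closure_of (e ` E) \<subseteq> e ` K" by (simp add: closure_of_minimal)
      moreover have "e x \<in> Y closure_of (e ` E)"
        using continuous_map_image_closure_subset[OF eY(1), of E] Edense x by blast
      ultimately obtain z where "z \<in> K" "e z = e x" by (metis imageE subsetD)
      then show "\<exists>z\<in>topspace (subtopology X K). \<forall>f\<in>F. f (id z) = f x"
        using TK(2) e_eq by (intro bexI[of _ z]) auto
    qed
    ultimately show False using not_ordLess_ordLeq by blast
  qed
  ultimately have "density (subtopology X D) =o \<mu>" using ordIso_iff_ordLeq by blast
  then show ?thesis using DD(1) unfolding dd_def by blast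
qed

end
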